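(* Consider the equation $u_{tt}-u_{xx}=(u_t)^2$ for real-valued $u(x,t)$. (1) For any $T>0$ and $x_0\in\mathbb{R}$, there are no nontrivial smooth exact self-similar blow-up solutions of the equation in the past light cone $\Gamma(x_0,T)$. Equivalently: apart from the constant profiles $\widetilde U\equiv\kappa$ ($\kappa\in\mathbb{R}$), there is no smooth profile $\widetilde U$ on $\{|y|\le 1\}$ such that $u(x,t)=\widetilde U\!\left(\frac{x-x_0}{T-t}\right)$ solves the equation in $\Gamma(x_0,T)$. (2) There exists a five-parameter family of smooth generalised self-similar blow-up solutions of the equation with logarithmic growth, namely \[ u_{p,q,\kappa,T,x_0}(x,t)=-p\log\!\Big(1-\frac{t}{T}\Big)-p\log\!\Big(1+q\sqrt{1-p}\,\frac{x-x_0}{T-t}\Big)+\kappa , \] which are smooth solutions in the past light cone $\Gamma(x_0,T)$ for all $T>0$, $\kappa,x_0\in\mathbb{R}$, $q\in\{\pm1\}$ and $p\in(0,1]$. In terms of the similarity variables $\tau=-\log(1-t/T)$, $y=\frac{x-x_0}{T-t}$ these solutions read \[ u_{p,q,\kappa,T,x_0}(x,t)=U_{p,q,\kappa}(\tau,y)=p\,\tau+\widetilde U_{p,q,\kappa}(y),\qquad \widetilde U_{p,q,\kappa}(y)=-p\log\!\big(1+q\sqrt{1-p}\,y\big)+\kappa . \] In particular, $u_{1,q,\kappa,T,x_0}(x,t)=-\log(1-\frac{t}{T})+\kappa$ is the spatially homogeneous ODE-type blow-up, and the two signs are related by spatial reflection: $u_{p,-1,\kappa,T,x_0}(x,t)=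u_{p,1,\kappa,T,-x_0}(-x,t)$.
   Context: For $x_0\in\mathbb{R}$, $T>0$, the past light cone is $\Gamma(x_0,T)=\{(x,t)\in\mathbb{R}\times[0,T): |x-x_0|\le T-t\}$; in the variable $y=\frac{x-x_0}{T-t}$ it corresponds to $\{|y|\le 1\}$. An exact self-similar solution is one of the form $u(x,t)=\widetilde U(y)$; a generalised self-similar solution is one of the form $u(x,t)=p\tau+\widetilde U(y)$ with $p\in\mathbb{R}$ and $\tau=-\log(1-t/T)$. A profile is smooth on $\{|y|\le1\}$ if it belongs to $C^\infty[-1,1]$ (smooth with all derivatives continuous up to the endpoints). *)

theory Defs
  imports "HOL-Analysis.Analysis"
begin

definition light_cone :: "real \<Rightarrow> real \<Rightarrow> (real \<times> real) set" where
  "light_cone x0 T = {(x, t). 0 \<le> t \<and> t < T \<and> \<bar>x - x0\<bar> \<le> T - t}"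

definition sim_y :: "real \<Rightarrow> real \<Rightarrow> real \<Rightarrow> real \<Rightarrow> real" where
  "sim_y x0 T x t = (x - x0) / (T - t)"

definition sim_tau :: "real \<Rightarrow> real \<Rightarrow> real" where
  "sim_tau T t = - ln (1 - t / T)"

(* C^infinity[-1,1]: the family D consists of the successive derivatives of U, one-sided at the
   endpoints. Each is continuous up to the endpoints because it is itself differentiable there.
   Values of U outside [-1,1] play no role. *)
definition smooth_profile :: "(real \<Rightarrow> real) \<Rightarrow> bool" where
  "smooth_profile U \<longleftrightarrow>
     (\<exists>D :: nat \<Rightarrow> real \<Rightarrow> real.
        (\<forall>y\<in>{-1..1}. D 0 y = U y) \<and>
        (\<forall>n. \<forall>y\<in>{-1..1}. (D n has_real_derivative D (Suc n) y) (at y within {-1..1})))"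

(* D i j is the partial derivative of u taken i times in x and j times in t, up to the boundary
   of S. Frechet derivatives relative to S are used because at the corners (x0 + T, 0) and
   (x0 - T, 0) of the light cone the vertical slice is a single point, so that a one-sided
   t-derivative would be meaningless there. If S is convex with nonempty interior (as the light
   cone is for T > 0), the values of D on S are determined by u. *)
definition partials_on ::
  "(real \<times> real) set \<Rightarrow> (real \<times> real \<Rightarrow> real) \<Rightarrow> (nat \<Rightarrow> nat \<Rightarrow> real \<times> real \<Rightarrow> real) \<Rightarrow> bool" where
  "partials_on S u D \<longleftrightarrow>
     (\<forall>z\<in>S. D 0 0 z = u z) \<and>
     (\<forall>i j. \<forall>z\<in>S. (D i j has_derivative
        (\<lambda>(h, k). h * D (Suc i) j z + k * D i (Suc j) z)) (at z within S))"

(* u_tt - u_xx = (u_t)^2 for u smooth on the whole cone, boundary included. *)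
definition smooth_solution :: "real \<Rightarrow> real \<Rightarrow> (real \<times> real \<Rightarrow> real) \<Rightarrow> bool" where
  "smooth_solution x0 T u \<longleftrightarrow>
     (\<exists>D. partials_on (light_cone x0 T) u D \<and>
        (\<forall>z\<in>light_cone x0 T. D 0 2 z - D 2 0 z = (D 0 1 z)\<^sup>2))"

definition exact_self_similar :: "real \<Rightarrow> real \<Rightarrow> (real \<times> real \<Rightarrow> real) \<Rightarrow> bool" where
  "exact_self_similar x0 T u \<longleftrightarrow>
     (\<exists>U :: real \<Rightarrow> real. \<forall>(x, t)\<in>light_cone x0 T. u (x, t) = U (sim_y x0 T x t))"

definition generalised_self_similar ::
  "real \<Rightarrow> (real \<Rightarrow> real) \<Rightarrow> real \<Rightarrow> real \<Rightarrow> (real \<times> real \<Rightarrow> real) \<Rightarrow> bool" where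
  "generalised_self_similar p U x0 T u \<longleftrightarrow>
     (\<forall>(x, t)\<in>light_cone x0 T. u (x, t) = p * sim_tau T t + U (sim_y x0 T x t))"

definition u_fam ::
  "real \<Rightarrow> real \<Rightarrow> real \<Rightarrow> real \<Rightarrow> real \<Rightarrow> real \<times> real \<Rightarrow> real" where
  "u_fam p q \<kappa> T x0 = (\<lambda>(x, t).
     - p * ln (1 - t / T) - p * ln (1 + q * sqrt (1 - p) * ((x - x0) / (T - t))) + \<kappa>)"

definition U_fam :: "real \<Rightarrow> real \<Rightarrow> real \<Rightarrow> real \<Rightarrow> real" where
  "U_fam p q \<kappa> y = - p * ln (1 + q * sqrt (1 - p) * y) + \<kappa>"

end

theory Submission
  imports Defs
begin

text \<open>
  Part (1) rests on a monotone quantity.  A solution that is constant on the rays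
  \<open>y = const\<close> satisfies, with \<open>W = U'\<close>,
  \<open>(y\<^sup>2 - 1) W' + 2 y W = y\<^sup>2 W\<^sup>2\<close>, that is
  \<open>((y\<^sup>2 - 1) W)' = y\<^sup>2 W\<^sup>2 \<ge> 0\<close>.  The function \<open>(y\<^sup>2 - 1) W\<close> is therefore
  nondecreasing on \<open>[-1, 1]\<close>, and smoothness up to the light cone makes it vanish at both
  endpoints.  Hence it is zero, \<open>W = 0\<close> inside, and \<open>U\<close> is constant.  All of this can be read
  off on the bottom slice \<open>t = 0\<close> of the cone, where \<open>W = T u\<^sub>x\<close>: constancy along rays gives
  \<open>u\<^sub>t = y u\<^sub>x\<close>, and one more derivative of this relation, along the ray and along the slice,
  expresses \<open>u\<^sub>t\<^sub>t\<close> through \<open>u\<^sub>x\<close> and \<open>u\<^sub>x\<^sub>x\<close> (\<open>ray_constant_equation\<close>,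
  \<open>exact_self_similar_constant\<close>).

  For part (2), with \<open>a = q sqrt (1 - p)\<close> the two logarithms combine into
  \<open>u = - p ln (L / T) + \<kappa>\<close> where \<open>L = T - t + a (x - x0)\<close> is affine and, since
  \<open>\<bar>a\<bar> < 1\<close>, positive on the cone.  Every partial derivative of such a function is
  a multiple of a derivative of \<open>ln\<close> at \<open>L\<close>; the equation reduces to
  \<open>p (1 - a\<^sup>2) = p\<^sup>2\<close>, and blow-up at the tip holds because \<open>L\<close> tends to \<open>0\<close> from above there.
\<close>

section \<open>Derivatives relative to the light cone\<close>

lemma has_derivative_partials_on:
  assumes "partials_on S u D" "z \<in> S"
  shows "(D i j has_derivative (\<lambda>(h, k). h * D (Suc i) j z + k * D i (Suc j) z)) (at z within S)"
  using assms unfolding partials_on_def by blast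

lemma partials_on_cong:
  assumes "partials_on S u D" "\<And>z. z \<in> S \<Longrightarrow> u z = v z"
  shows "partials_on S v D"
  using assms by (simp add: partials_on_def)

text \<open>
  A derivative relative to \<open>S\<close> can be restricted to any curve inside \<open>S\<close>, including a
  curve that starts or runs on the boundary.  Every derivative of a given solution is
  taken through this chain rule; the one-sided derivatives that it yields at the ends of a parameter
  interval are still unique.
\<close>

lemma partials_on_along_curve:
  assumes D: "partials_on S u D"
    and c: "(c has_vector_derivative (h, k)) (at s within A)"
    and sub: "c ` A \<subseteq> S" and s: "s \<in> A"
  shows "((\<lambda>s. D i j (c s)) has_real_derivative
            h * D (Suc i) j (c s) + k * D i (Suc j) (c s)) (at s within A)"
proof -
  have "(D i j has_derivative (\<lambda>(h, k). h * D (Suc i) j (c s) + k * D i (Suc j) (c s)))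
          (at (c s) within c ` A)"
    using has_derivative_partials_on[OF D] sub s by (blast intro: has_derivative_subset)
  from has_derivative_in_compose[OF c[unfolded has_vector_derivative_def] this]
  show ?thesis
    unfolding has_field_derivative_def
    by (rule has_derivative_eq_rhs) (auto simp: algebra_simps)
qed

lemma real_derivative_unique_within_closed_interval:
  fixes f :: "real \<Rightarrow> real"
  assumes "a < b" "x \<in> {a..b}"
    and "(f has_real_derivative d) (at x within {a..b})"
    and "(f has_real_derivative e) (at x within {a..b})"
  shows "d = e"
  using vector_derivative_unique_within_closed_interval[of a b x f d e] assms
  by (simp add: has_real_derivative_iff_has_vector_derivative)

lemma light_cone_ray:
  assumes "0 < s" "s \<le> T" "\<bar>y\<bar> \<le> 1"
  shows "(x0 + s * y, T - s) \<in> light_cone x0 T"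
    and "sim_y x0 T (x0 + s * y) (T - s) = y"
proof -
  have "\<bar>s * y\<bar> \<le> s"
    unfolding abs_mult using assms by (simp add: mult_left_le)
  then show "(x0 + s * y, T - s) \<in> light_cone x0 T"
    using assms by (simp add: light_cone_def)
  show "sim_y x0 T (x0 + s * y) (T - s) = y"
    using assms by (simp add: sim_y_def)
qed

lemma sim_y_bounded:
  assumes "(x, t) \<in> light_cone x0 T"
  shows "\<bar>sim_y x0 T x t\<bar> \<le> 1"
  using assms by (simp add: light_cone_def sim_y_def)

section \<open>Exact self-similar solutions are constant\<close>

text \<open>
  Differentiating \<open>u (x0 + s y, T - s) = U y\<close> in \<open>s\<close>.  Rays are followed for
  \<open>s \<in> [T/2, T]\<close> only, so that the one-sided derivative at \<open>s = T\<close>, on the bottom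
  slice, is available without approaching the tip of the cone.
\<close>

lemma ray_constant_first_order:
  assumes D: "partials_on (light_cone x0 T) u D" and T: "0 < T"
    and U: "\<forall>(x, t)\<in>light_cone x0 T. u (x, t) = U (sim_y x0 T x t)"
    and y: "\<bar>y\<bar> \<le> 1" and s: "s \<in> {T/2..T}"
  shows "D 0 1 (x0 + s * y, T - s) = y * D 1 0 (x0 + s * y, T - s)"
proof -
  let ?c = "\<lambda>s. (x0 + s * y, T - s)"
  have sub: "?c ` {T/2..T} \<subseteq> light_cone x0 T"
    using light_cone_ray(1)[OF _ _ y] T by auto
  have c: "(?c has_vector_derivative (y, -1)) (at s within {T/2..T})"
    by (auto intro!: derivative_eq_intros simp: has_vector_derivative_def scaleR_prod_def)
  have "((\<lambda>s. D 0 0 (?c s)) has_real_derivative 0) (at s within {T/2..T})"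
  proof (rule has_field_derivative_transform_within[OF DERIV_const zero_less_one s])
    fix s' assume "s' \<in> {T/2..T}"
    then have "0 < s'" "s' \<le> T" using T by auto
    then show "U y = D 0 0 (?c s')"
      using D U light_cone_ray[OF _ _ y] unfolding partials_on_def
      by (fastforce simp: case_prod_unfold)
  qed
  moreover note partials_on_along_curve[OF D c sub s, of 0 0]
  ultimately have "y * D (Suc 0) 0 (?c s) + (-1) * D 0 (Suc 0) (?c s) = 0"
    using T s by (intro real_derivative_unique_within_closed_interval[of "T/2" T s]) auto
  then show ?thesis by simp
qed

text \<open>
  The profile equation on the bottom slice.  Differentiating \<open>u\<^sub>t = y u\<^sub>x\<close> along the ray
  gives \<open>u\<^sub>t\<^sub>t = 2 y u\<^sub>x\<^sub>t - y\<^sup>2 u\<^sub>x\<^sub>x\<close>, and along the slice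
  \<open>T u\<^sub>x\<^sub>t = u\<^sub>x + T y u\<^sub>x\<^sub>x\<close>; eliminating \<open>u\<^sub>x\<^sub>t\<close> and \<open>u\<^sub>t\<^sub>t\<close> from the wave
  equation leaves an equation for \<open>u\<^sub>x\<close> alone.
\<close>

lemma ray_constant_equation:
  assumes D: "partials_on (light_cone x0 T) u D" and T: "0 < T"
    and U: "\<forall>(x, t)\<in>light_cone x0 T. u (x, t) = U (sim_y x0 T x t)"
    and eq: "\<forall>z\<in>light_cone x0 T. D 0 2 z - D 2 0 z = (D 0 1 z)\<^sup>2"
    and y: "\<bar>y\<bar> \<le> 1"
  shows "2 * y * D 1 0 (x0 + T * y, 0) + (y\<^sup>2 - 1) * (T * D 2 0 (x0 + T * y, 0))
           = T * (y * D 1 0 (x0 + T * y, 0))\<^sup>2"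
proof -
  let ?z = "(x0 + T * y, 0)"
  let ?c = "\<lambda>s. (x0 + s * y, T - s)"
  let ?b = "\<lambda>y. (x0 + T * y, 0)"
  note first = ray_constant_first_order[OF D T U]
  have z: "?z \<in> light_cone x0 T" using light_cone_ray(1)[of T T y x0] T y by simp
  have ray: "D 0 2 ?z = 2 * y * D 1 1 ?z - y\<^sup>2 * D 2 0 ?z"
  proof -
    have sub: "?c ` {T/2..T} \<subseteq> light_cone x0 T"
      using light_cone_ray(1)[OF _ _ y] T by auto
    have c: "(?c has_vector_derivative (y, -1)) (at T within {T/2..T})"
      by (auto intro!: derivative_eq_intros simp: has_vector_derivative_def scaleR_prod_def)
    have mem: "T \<in> {T/2..T}" using T by simp
    have "((\<lambda>s. y * D 1 0 (?c s)) has_real_derivative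
             y * (y * D 2 0 ?z - D 1 1 ?z)) (at T within {T/2..T})"
      using DERIV_cmult[OF partials_on_along_curve[OF D c sub mem, of 1 0], of y]
      by (simp add: numeral_2_eq_2)
    then have "((\<lambda>s. D 0 1 (?c s)) has_real_derivative
             y * (y * D 2 0 ?z - D 1 1 ?z)) (at T within {T/2..T})"
      by (rule has_field_derivative_transform_within[OF _ zero_less_one mem])
         (rule first[OF y, symmetric])
    moreover note partials_on_along_curve[OF D c sub mem, of 0 1]
    ultimately have "y * D 1 1 ?z - D 0 2 ?z = y * (y * D 2 0 ?z - D 1 1 ?z)"
      using T real_derivative_unique_within_closed_interval[of "T/2" T T]
      by (fastforce simp: numeral_2_eq_2)
    then show ?thesis by (simp add: algebra_simps power2_eq_square)
  qed
  have slice: "T * D 1 1 ?z = D 1 0 ?z + T * y * D 2 0 ?z"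
  proof -
    have sub: "?b ` {-1..1} \<subseteq> light_cone x0 T"
      using light_cone_ray(1)[of T T _ x0] T by (auto simp: abs_le_iff)
    have b: "(?b has_vector_derivative (T, 0)) (at y within {-1..1})"
      by (auto intro!: derivative_eq_intros simp: has_vector_derivative_def scaleR_prod_def)
    have mem: "y \<in> {-1..1}" using y by auto
    have "((\<lambda>y. y * D 1 0 (?b y)) has_real_derivative
             (D 1 0 ?z + y * (T * D 2 0 ?z))) (at y within {-1..1})"
      using partials_on_along_curve[OF D b sub mem, of 1 0]
      by (auto intro!: derivative_eq_intros simp: numeral_2_eq_2)
    then have "((\<lambda>y. D 0 1 (?b y)) has_real_derivative
             (D 1 0 ?z + y * (T * D 2 0 ?z))) (at y within {-1..1})"
      by (rule has_field_derivative_transform_within[OF _ zero_less_one mem])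
         (use first[of _ T] T in \<open>auto simp: abs_le_iff\<close>)
    moreover note partials_on_along_curve[OF D b sub mem, of 0 1]
    ultimately have "T * D 1 1 ?z = D 1 0 ?z + y * (T * D 2 0 ?z)"
      using mem real_derivative_unique_within_closed_interval[of "-1" 1 y] by fastforce
    then show ?thesis by simp
  qed
  have "(y * D 1 0 ?z)\<^sup>2 = D 0 2 ?z - D 2 0 ?z"
    using eq[rule_format, OF z] first[OF y, of T] T by simp
  then have "T * (y * D 1 0 ?z)\<^sup>2 = T * (D 0 2 ?z - D 2 0 ?z)"
    by (rule arg_cong)
  also have "\<dots> = 2 * y * (T * D 1 1 ?z) - y\<^sup>2 * (T * D 2 0 ?z) - T * D 2 0 ?z"
    unfolding ray by (simp add: algebra_simps)
  finally show ?thesis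
    unfolding slice by (simp add: algebra_simps power2_eq_square)
qed

text \<open>
  The weight \<open>y\<^sup>2 - 1\<close> vanishes at \<open>y = \<plusminus>1\<close>, and \<open>u\<^sub>x\<close> is finite there because
  the solution is smooth up to the boundary; a nondecreasing function with equal end values
  is constant.
\<close>

lemma exact_self_similar_constant:
  assumes sol: "smooth_solution x0 T u" and T: "0 < T"
    and U: "\<forall>(x, t)\<in>light_cone x0 T. u (x, t) = U (sim_y x0 T x t)"
    and y: "y \<in> {-1..1}"
  shows "U y = U 0"
proof -
  obtain D where D: "partials_on (light_cone x0 T) u D"
    and eq: "\<forall>z\<in>light_cone x0 T. D 0 2 z - D 2 0 z = (D 0 1 z)\<^sup>2"
    using sol unfolding smooth_solution_def by blast
  let ?b = "\<lambda>y. (x0 + T * y, 0)"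
  have sub: "?b ` {-1..1} \<subseteq> light_cone x0 T"
    using light_cone_ray(1)[of T T _ x0] T by (auto simp: abs_le_iff)
  have b: "(?b has_vector_derivative (T, 0)) (at y within {-1..1})" for y
    by (auto intro!: derivative_eq_intros simp: has_vector_derivative_def scaleR_prod_def)
  note along = partials_on_along_curve[OF D b sub]
  \<comment> \<open>up to the factor \<open>T\<close> this is \<open>(y\<^sup>2 - 1) U' y\<close>\<close>
  define V where "V y = (y\<^sup>2 - 1) * D 1 0 (?b y)" for y
  have dV: "(V has_real_derivative T * (y * D 1 0 (?b y))\<^sup>2) (at y within {-1..1})"
    if "y \<in> {-1..1}" for y
  proof -
    have "(V has_real_derivative
        2 * y * D 1 0 (?b y) + (y\<^sup>2 - 1) * (T * D 2 0 (?b y))) (at y within {-1..1})"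
      unfolding V_def using along[OF that, of 1 0]
      by (auto intro!: derivative_eq_intros simp: numeral_2_eq_2)
    then show ?thesis
      using ray_constant_equation[OF D T U eq, of y] that by (simp add: abs_le_iff)
  qed
  have mono: "V a \<le> V c" if "-1 \<le> a" "a \<le> c" "c \<le> 1" for a c
  proof (rule DERIV_nonneg_imp_increasing_open[of a c V])
    show "a \<le> c" by fact
    have "continuous_on {-1..1} V"
      using dV unfolding continuous_on_eq_continuous_within by (blast intro: DERIV_continuous)
    then show "continuous_on {a..c} V"
      by (rule continuous_on_subset) (use that in auto)
    fix y assume "a < y" "y < c"
    then have "-1 < y" "y < 1" using that by auto
    then have "(V has_real_derivative T * (y * D 1 0 (?b y))\<^sup>2) (at y)"
      using dV[of y] at_within_Icc_at[of "-1" y 1] by simp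
    then show "\<exists>d. (V has_real_derivative d) (at y) \<and> d \<ge> 0"
      using T by (intro exI[of _ "T * (y * D 1 0 (?b y))\<^sup>2"]) simp
  qed
  have "V (-1) = 0" "V 1 = 0" by (simp_all add: V_def)
  then have V0: "V y = 0" if "y \<in> {-1..1}" for y
    using mono[of "-1" y] mono[of y 1] that by auto
  have zero: "D 1 0 (?b y) = 0" if "y \<in> {-1<..<1}" for y
  proof -
    have "y\<^sup>2 < 1" using that by (simp add: abs_square_less_1 abs_less_iff)
    then show ?thesis using V0[of y] that by (auto simp: V_def)
  qed
  have UD: "U y = D 0 0 (?b y)" if "y \<in> {-1..1}" for y
    using that D U light_cone_ray[of T T y x0] T unfolding partials_on_def
    by (auto simp: abs_le_iff)
  have dU: "(U has_real_derivative T * D 1 0 (?b y)) (at y within {-1..1})"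
    if "y \<in> {-1..1}" for y
    by (rule has_field_derivative_transform_within[OF _ zero_less_one that])
       (use along[OF that, of 0 0] UD in simp_all)
  have "continuous_on {-1..1} U"
    using dU unfolding continuous_on_eq_continuous_within by (blast intro: DERIV_continuous)
  moreover have "(U has_real_derivative 0) (at y)" if "-1 < y" "y < 1" for y
    using dU[of y] zero[of y] that at_within_Icc_at[of "-1" y 1] by simp
  ultimately have "U c = U (-1)" if "c \<in> {-1..1}" for c
    using DERIV_isconst2[of "-1" 1 U c] that by simp
  from this[of y] this[of 0] show ?thesis using y by simp
qed

section \<open>Functions of an affine variable\<close>

fun ln_deriv :: "nat \<Rightarrow> real \<Rightarrow> real" where
  "ln_deriv 0 r = ln r"
| "ln_deriv (Suc n) r = (-1) ^ n * fact n / r ^ Suc n"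

lemma has_real_derivative_ln_deriv:
  assumes "0 < r"
  shows "(ln_deriv n has_real_derivative ln_deriv (Suc n) r) (at r within A)"
proof (cases n)
  case 0
  have "ln_deriv 0 = ln" by auto
  then show ?thesis using assms 0 by (auto intro!: derivative_eq_intros simp: field_simps)
next
  case (Suc m)
  have "ln_deriv (Suc m) = (\<lambda>r. (-1) ^ m * fact m / r ^ Suc m)" by auto
  moreover have "((\<lambda>r. (-1) ^ m * fact m / r ^ Suc m) has_real_derivative
      - ((-1) ^ m * fact m * (real (Suc m) * r ^ m)) / (r ^ Suc m * r ^ Suc m)) (at r within A)"
    using assms by (auto intro!: derivative_eq_intros simp del: power_Suc of_nat_Suc)
  moreover have "- ((-1) ^ m * fact m * (real (Suc m) * r ^ m)) / (r ^ Suc m * r ^ Suc m)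
      = ln_deriv (Suc (Suc m)) r"
    using assms by (simp add: field_simps)
  ultimately show ?thesis unfolding Suc by simp
qed

text \<open>
  Each derivative in \<open>x\<close> or \<open>t\<close> raises the order of the derivative of \<open>ln\<close> by one and
  brings out a factor \<open>a\<close> or \<open>b\<close>; only the function itself, at order \<open>0\<close>, carries the
  additive constant.
\<close>

lemma partials_on_ln_affine:
  assumes pos: "\<And>x t. (x, t) \<in> S \<Longrightarrow> 0 < a * x + b * t + c"
  shows "partials_on S (\<lambda>(x, t). m * ln (a * x + b * t + c) + k)
     (\<lambda>i j (x, t). m * (a ^ i * b ^ j * ln_deriv (i + j) (a * x + b * t + c))
                   + (if i + j = 0 then k else 0))"
proof -
  have deriv: "((\<lambda>(x, t). m * (a ^ i * b ^ j * ln_deriv (i + j) (a * x + b * t + c)) + e)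
     has_derivative (\<lambda>(h, l). 
        h * (m * (a ^ Suc i * b ^ j * ln_deriv (Suc (i + j)) (a * x + b * t + c))) +
        l * (m * (a ^ i * b ^ Suc j * ln_deriv (Suc (i + j)) (a * x + b * t + c)))))
      (at (x, t) within S)" if "(x, t) \<in> S" for i j x t e
  proof -
    let ?L = "\<lambda>z. a * fst z + b * snd z + c"
    have L: "(?L has_derivative (\<lambda>z. a * fst z + b * snd z)) (at (x, t) within S)"
      by (auto intro!: derivative_eq_intros)
    have "(ln_deriv (i + j) has_derivative (*) (ln_deriv (Suc (i + j)) (?L (x, t))))
        (at (?L (x, t)) within ?L ` S)"
      using has_real_derivative_ln_deriv[OF pos[OF that]]
      by (simp add: has_field_derivative_def)
    from has_derivative_in_compose[OF L this]
    have "((\<lambda>z. ln_deriv (i + j) (?L z)) has_derivative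
       (\<lambda>z. ln_deriv (Suc (i + j)) (?L (x, t)) * (a * fst z + b * snd z))) (at (x, t) within S)"
      by simp
    then show ?thesis
      unfolding case_prod_unfold
      by (auto intro!: derivative_eq_intros simp del: ln_deriv.simps simp: algebra_simps)
  qed
  show ?thesis unfolding partials_on_def
  proof (intro conjI allI ballI)
    fix i j z assume "z \<in> S"
    then obtain x t where z: "z = (x, t)" "(x, t) \<in> S" by (cases z) auto
    show "((\<lambda>(x, t). m * (a ^ i * b ^ j * ln_deriv (i + j) (a * x + b * t + c))
                   + (if i + j = 0 then k else 0)) has_derivative
        (\<lambda>(h, l). h * (case z of (x, t) \<Rightarrow>
             m * (a ^ Suc i * b ^ j * ln_deriv (Suc i + j) (a * x + b * t + c))
               + (if Suc i + j = 0 then k else 0)) +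
           l * (case z of (x, t) \<Rightarrow>
             m * (a ^ i * b ^ Suc j * ln_deriv (i + Suc j) (a * x + b * t + c))
               + (if i + Suc j = 0 then k else 0)))) (at z within S)"
      using deriv[OF z(2), of i j "if i + j = 0 then k else 0"]
      unfolding z(1) by (simp only: add_Suc add_Suc_right nat.distinct if_False add_0_right case_prod_conv)
  qed auto
qed

lemma smooth_profile_ln_affine:
  assumes pos: "\<And>y. y \<in> {-1..1} \<Longrightarrow> 0 < 1 + a * y"
  shows "smooth_profile (\<lambda>y. m * ln (1 + a * y) + k)"
proof -
  let ?D = "\<lambda>n y. m * (a ^ n * ln_deriv n (1 + a * y)) + (if n = 0 then k else 0)"
  have "(?D n has_real_derivative ?D (Suc n) y) (at y within {-1..1})" if y: "y \<in> {-1..1}" for n y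
  proof -
  have "((\<lambda>y. 1 + a * y) has_real_derivative a) (at y within {-1..1})"
    by (auto intro!: derivative_eq_intros)
  from DERIV_chain'[OF this has_real_derivative_ln_deriv[OF pos[OF y]], of n]
  have "((\<lambda>y. ln_deriv n (1 + a * y)) has_real_derivative ln_deriv (Suc n) (1 + a * y) * a)
         (at y within {-1..1})" by (simp add: mult.commute)
  then show ?thesis
    by (auto intro!: derivative_eq_intros simp del: ln_deriv.simps simp: algebra_simps)
  qed
  then show ?thesis unfolding smooth_profile_def by (intro exI[of _ ?D]) simp
qed

section \<open>The five-parameter family\<close>

context
  fixes p q a T x0 \<kappa> :: real
  assumes p: "0 < p" "p \<le> 1" and q: "q \<in> {-1, 1}" and T: "0 < T"
  defines "a \<equiv> q * sqrt (1 - p)"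
begin

lemma slope_square: "a\<^sup>2 = 1 - p"
  using p q by (auto simp: a_def power_mult_distrib)

lemma slope_bound: "\<bar>a\<bar> < 1"
  unfolding abs_square_less_1[symmetric] slope_square using p by simp

lemma affine_factor_pos:
  assumes "\<bar>y\<bar> \<le> 1"
  shows "0 < 1 + a * y"
proof -
  have "\<bar>a * y\<bar> \<le> \<bar>a\<bar>"
    unfolding abs_mult by (rule mult_left_le[OF assms]) simp
  then show ?thesis using slope_bound by linarith
qed

lemma light_cone_factors_pos:
  assumes "(x, t) \<in> light_cone x0 T"
  shows "0 < 1 - t / T" "0 < 1 + a * ((x - x0) / (T - t))"
proof -
  show "0 < 1 - t / T" using assms T by (simp add: light_cone_def)
  show "0 < 1 + a * ((x - x0) / (T - t))"
    using affine_factor_pos[OF sim_y_bounded[OF assms]] by (simp only: sim_y_def)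
qed

text \<open>
  The singular denominator \<open>T - t\<close> cancels between the two arguments of \<open>ln\<close>: their
  product is the affine function \<open>(T - t + a (x - x0)) / T\<close>, and only its \<open>ln\<close> is
  left to differentiate.
\<close>

lemma light_cone_product_of_factors:
  assumes "(x, t) \<in> light_cone x0 T"
  shows "(1 - t / T) * (1 + a * ((x - x0) / (T - t)))
           = a / T * x + (- 1 / T) * t + (1 - a * x0 / T)"
proof -
  have cancel: "(1 - t / T) * ((x - x0) / (T - t)) = (x - x0) / T"
  proof -
    have "T - t \<noteq> 0" using assms by (auto simp: light_cone_def)
    moreover have "1 - t / T = (T - t) / T" using T by (simp add: diff_divide_distrib)
    ultimately show ?thesis by (simp only: times_divide_times_eq) simp
  qed
  have "(1 - t / T) * (1 + a * ((x - x0) / (T - t)))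
          = (1 - t / T) + a * ((1 - t / T) * ((x - x0) / (T - t)))"
    by (simp only: distrib_left mult_1_right mult.left_commute)
  also have "\<dots> = a / T * x + (- 1 / T) * t + (1 - a * x0 / T)"
    unfolding cancel by (simp add: diff_divide_distrib right_diff_distrib)
  finally show ?thesis .
qed

lemma affine_pos:
  assumes "(x, t) \<in> light_cone x0 T"
  shows "0 < a / T * x + (- 1 / T) * t + (1 - a * x0 / T)"
  unfolding light_cone_product_of_factors[OF assms, symmetric]
  by (intro mult_pos_pos light_cone_factors_pos[OF assms])

lemma u_fam_eq_ln_affine:
  assumes "(x, t) \<in> light_cone x0 T"
  shows "u_fam p q \<kappa> T x0 (x, t)
           = - p * ln (a / T * x + (- 1 / T) * t + (1 - a * x0 / T)) + \<kappa>"
  unfolding light_cone_product_of_factors[OF assms, symmetric]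
  unfolding ln_mult_pos[OF light_cone_factors_pos[OF assms]] u_fam_def case_prod_conv
    a_def[symmetric]
  by (simp only: distrib_left)

text \<open>
  With \<open>L\<close> now normalised by \<open>1/T\<close>, the derivatives are
  \<open>u\<^sub>t\<^sub>t = p / (T L)\<^sup>2\<close>, \<open>u\<^sub>x\<^sub>x = a\<^sup>2 p / (T L)\<^sup>2\<close> and \<open>u\<^sub>t = p / (T L)\<close>, so
  the equation holds exactly because \<open>1 - a\<^sup>2 = p\<close>.
\<close>

lemma smooth_solution_u_fam: "smooth_solution x0 T (u_fam p q \<kappa> T x0)"
proof -
  let ?L = "\<lambda>x t. a / T * x + (- 1 / T) * t + (1 - a * x0 / T)"
  let ?D = "\<lambda>i j (x, t). - p * ((a / T) ^ i * (- 1 / T) ^ j * ln_deriv (i + j) (?L x t))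
                   + (if i + j = 0 then \<kappa> else 0)"
  have "partials_on (light_cone x0 T) (\<lambda>(x, t). - p * ln (?L x t) + \<kappa>) ?D"
    by (rule partials_on_ln_affine) (rule affine_pos)
  then have "partials_on (light_cone x0 T) (u_fam p q \<kappa> T x0) ?D"
    by (rule partials_on_cong) (auto simp only: u_fam_eq_ln_affine case_prod_conv)
  moreover have "?D 0 2 z - ?D 2 0 z = (?D 0 1 z)\<^sup>2" if "z \<in> light_cone x0 T" for z
  proof -
    obtain x t where z: "z = (x, t)" by force
    define L where "L = ?L x t"
    have ln2: "ln_deriv 2 L = - 1 / L\<^sup>2" "ln_deriv (Suc (Suc 0)) L = - 1 / L\<^sup>2"
      by (simp_all add: numeral_2_eq_2)
    have "?D 0 2 z = p / (T * L)\<^sup>2"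
      unfolding z case_prod_conv L_def[symmetric]
      by (simp add: ln2 power_mult_distrib power_divide del: ln_deriv.simps)
    moreover have "?D 2 0 z = a\<^sup>2 * p / (T * L)\<^sup>2"
      unfolding z case_prod_conv L_def[symmetric]
      by (simp add: ln2 power_mult_distrib power_divide del: ln_deriv.simps)
    moreover have "?D 0 1 z = p / (T * L)"
      unfolding z case_prod_conv L_def[symmetric] by simp
    ultimately have "?D 0 2 z - ?D 2 0 z = p * (1 - a\<^sup>2) / (T * L)\<^sup>2"
      by (simp only: diff_divide_distrib) (simp add: algebra_simps diff_divide_distrib)
    also have "\<dots> = (?D 0 1 z)\<^sup>2"
      unfolding \<open>?D 0 1 z = p / (T * L)\<close> slope_square
      by (simp add: power2_eq_square)
    finally show ?thesis .
  qed
  ultimately show ?thesis unfolding smooth_solution_def by blast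
qed

lemma smooth_profile_U_fam: "smooth_profile (U_fam p q \<kappa>)"
proof -
  have "U_fam p q \<kappa> = (\<lambda>y. - p * ln (1 + a * y) + \<kappa>)"
    by (auto simp: U_fam_def a_def)
  moreover have "0 < 1 + a * y" if "y \<in> {-1..1}" for y
    using that affine_factor_pos by (auto simp: abs_le_iff)
  ultimately show ?thesis using smooth_profile_ln_affine[of a "- p" \<kappa>] by simp
qed

text \<open>
  The affine function vanishes at the tip, and positivity on the cone makes its limit
  \<open>0\<close> one-sided, as the divergence of \<open>ln\<close> requires.
\<close>

lemma u_fam_blow_up:
  "filterlim (u_fam p q \<kappa> T x0) at_top (at (x0, T) within light_cone x0 T)"
proof -
  let ?F = "at (x0, T) within light_cone x0 T"
  let ?L = "\<lambda>z. a / T * fst z + (- 1 / T) * snd z + (1 - a * x0 / T)"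
  have in_cone: "\<forall>\<^sub>F z in ?F. z \<in> light_cone x0 T"
    by (simp add: eventually_at_filter)
  have pos: "\<forall>\<^sub>F z in ?F. ?L z \<in> {0<..}"
    using in_cone by eventually_elim (use affine_pos in force)
  have "(?L \<longlongrightarrow> ?L (x0, T)) ?F"
    by (intro tendsto_intros)
  moreover have "?L (x0, T) = 0" using T by simp
  ultimately have "filterlim ?L (at_right 0) ?F"
    using pos by (auto simp: filterlim_at elim: eventually_mono)
  then have "LIM z ?F. ln (?L z) :> at_bot"
    by (rule filterlim_compose[OF ln_at_0])
  then have "LIM z ?F. p * (- ln (?L z)) :> at_top"
    using p by (intro filterlim_tendsto_pos_mult_at_top[OF tendsto_const])
               (auto simp: filterlim_uminus_at_top)
  then have "LIM z ?F. \<kappa> + p * (- ln (?L z)) :> at_top"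
    by (rule filterlim_tendsto_add_at_top[OF tendsto_const])
  then show ?thesis
  proof (rule filterlim_mono_eventually[OF _ order_refl order_refl])
    show "\<forall>\<^sub>F z in ?F. \<kappa> + p * (- ln (?L z)) = u_fam p q \<kappa> T x0 z"
      using in_cone by eventually_elim (use u_fam_eq_ln_affine in force)
  qed
qed

end

theorem theorem1p1:
  shows
    "(\<forall>T x0 :: real. T > 0 \<longrightarrow>
        (\<nexists>u. smooth_solution x0 T u \<and> exact_self_similar x0 T u \<and>
             \<not> (\<exists>\<kappa>. \<forall>z\<in>light_cone x0 T. u z = \<kappa>)) \<and>
        (\<forall>U. smooth_profile U \<and> smooth_solution x0 T (\<lambda>(x, t). U (sim_y x0 T x t)) \<longleftrightarrow>
             (\<exists>\<kappa>. \<forall>y\<in>{-1..1}. U y = \<kappa>)))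
     \<and>
     (\<forall>p q \<kappa> T x0 :: real. 0 < p \<and> p \<le> 1 \<and> q \<in> {-1, 1} \<and> T > 0 \<longrightarrow>
        (\<forall>(x, t)\<in>light_cone x0 T.
            0 < 1 - t / T \<and> 0 < 1 + q * sqrt (1 - p) * ((x - x0) / (T - t))) \<and>
        smooth_solution x0 T (u_fam p q \<kappa> T x0) \<and>
        smooth_profile (U_fam p q \<kappa>) \<and>
        generalised_self_similar p (U_fam p q \<kappa>) x0 T (u_fam p q \<kappa> T x0) \<and>
        filterlim (u_fam p q \<kappa> T x0) at_top (at (x0, T) within light_cone x0 T))
     \<and>
     (\<forall>q \<kappa> T x0 :: real. q \<in> {-1, 1} \<and> T > 0 \<longrightarrow>
        (\<forall>(x, t)\<in>light_cone x0 T. u_fam 1 q \<kappa> T x0 (x, t) = - ln (1 - t / T) + \<kappa>))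
     \<and>
     (\<forall>p \<kappa> T x0 :: real. 0 < p \<and> p \<le> 1 \<and> T > 0 \<longrightarrow>
        (\<forall>(x, t)\<in>light_cone x0 T.
            u_fam p (-1) \<kappa> T x0 (x, t) = u_fam p 1 \<kappa> T (- x0) (- x, t)))"
proof (intro conjI allI impI)
  fix T x0 :: real assume T: "T > 0"
  have const: "smooth_solution x0 T u"
    if "\<And>z. z \<in> light_cone x0 T \<Longrightarrow> u z = \<kappa>" for u \<kappa>
    unfolding smooth_solution_def partials_on_def
    by (rule exI[of _ "\<lambda>i j z. if i + j = 0 then \<kappa> else 0"])
       (auto simp: that case_prod_unfold)
  show "\<nexists>u. smooth_solution x0 T u \<and> exact_self_similar x0 T u \<and>
             \<not> (\<exists>\<kappa>. \<forall>z\<in>light_cone x0 T. u z = \<kappa>)"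
  proof (rule notI, elim exE conjE)
    fix u assume u: "smooth_solution x0 T u" "exact_self_similar x0 T u"
      and nc: "\<not> (\<exists>\<kappa>. \<forall>z\<in>light_cone x0 T. u z = \<kappa>)"
    from u(2) obtain U where
      U: "\<forall>(x, t)\<in>light_cone x0 T. u (x, t) = U (sim_y x0 T x t)"
      unfolding exact_self_similar_def by blast
    have "u (x, t) = U 0" if "(x, t) \<in> light_cone x0 T" for x t
    proof -
      have "u (x, t) = U (sim_y x0 T x t)" using U that by blast
      also have "\<dots> = U 0"
        using sim_y_bounded[OF that]
        by (intro exact_self_similar_constant[OF u(1) T U]) (simp add: abs_le_iff)
      finally show ?thesis .
    qed
    then have "\<forall>z\<in>light_cone x0 T. u z = U 0" by (simp add: split_paired_all)
    then show False using nc by blast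
  qed
  show "smooth_profile U \<and> smooth_solution x0 T (\<lambda>(x, t). U (sim_y x0 T x t)) \<longleftrightarrow>
             (\<exists>\<kappa>. \<forall>y\<in>{-1..1}. U y = \<kappa>)" for U
  proof
    assume sol: "smooth_profile U \<and> smooth_solution x0 T (\<lambda>(x, t). U (sim_y x0 T x t))"
    have "U y = U 0" if "y \<in> {-1..1}" for y
      by (rule exact_self_similar_constant[where U = U, OF conjunct2[OF sol] T _ that]) simp
    then show "\<exists>\<kappa>. \<forall>y\<in>{-1..1}. U y = \<kappa>" by (intro exI ballI)
  next
    assume "\<exists>\<kappa>. \<forall>y\<in>{-1..1}. U y = \<kappa>"
    then obtain \<kappa> where \<kappa>: "\<And>y. y \<in> {-1..1} \<Longrightarrow> U y = \<kappa>" by blast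
    have "smooth_profile U"
      unfolding smooth_profile_def
      by (rule exI[of _ "\<lambda>n y. if n = 0 then \<kappa> else 0"]) (auto simp: \<kappa>)
    moreover have "smooth_solution x0 T (\<lambda>(x, t). U (sim_y x0 T x t))"
    proof (rule const)
      fix z assume "z \<in> light_cone x0 T"
      then show "(case z of (x, t) \<Rightarrow> U (sim_y x0 T x t)) = \<kappa>"
        using sim_y_bounded[of "fst z" "snd z" x0 T]
        by (cases z) (auto intro!: \<kappa> simp: abs_le_iff)
    qed
    ultimately show "smooth_profile U \<and> smooth_solution x0 T (\<lambda>(x, t). U (sim_y x0 T x t))" ..
  qed
next
  fix p q \<kappa> T x0 :: real
  assume "0 < p \<and> p \<le> 1 \<and> q \<in> {-1, 1} \<and> T > 0"
  then have h: "0 < p" "p \<le> 1" "q \<in> {-1, 1}" "0 < T" by auto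
  show "\<forall>(x, t)\<in>light_cone x0 T.
            0 < 1 - t / T \<and> 0 < 1 + q * sqrt (1 - p) * ((x - x0) / (T - t))"
    using light_cone_factors_pos[OF h] by blast
  show "smooth_solution x0 T (u_fam p q \<kappa> T x0)" by (rule smooth_solution_u_fam[OF h])
  show "smooth_profile (U_fam p q \<kappa>)" by (rule smooth_profile_U_fam[OF h])
  show "generalised_self_similar p (U_fam p q \<kappa>) x0 T (u_fam p q \<kappa> T x0)"
    by (auto simp: generalised_self_similar_def u_fam_def U_fam_def sim_tau_def sim_y_def)
  show "filterlim (u_fam p q \<kappa> T x0) at_top (at (x0, T) within light_cone x0 T)"
    by (rule u_fam_blow_up[OF h])
next
  fix q \<kappa> T x0 :: real
  show "\<forall>(x, t)\<in>light_cone x0 T. u_fam 1 q \<kappa> T x0 (x, t) = - ln (1 - t / T) + \<kappa>"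
    by (auto simp: u_fam_def)
next
  fix p \<kappa> T x0 :: real
  have "- x - - x0 = - (x - x0)" for x by simp
  then show "\<forall>(x, t)\<in>light_cone x0 T.
            u_fam p (-1) \<kappa> T x0 (x, t) = u_fam p 1 \<kappa> T (- x0) (- x, t)"
    unfolding u_fam_def by (auto simp only: case_prod_conv minus_divide_left[symmetric]) simp
qed

end
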